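(* For a finite multigraph $G=(V,E)$, set $\lambda_i=1+(d_i-1)\beta$ for $i\in V$. Then $$\omega_G(\beta)=\Xi_G(-\beta,\boldsymbol\lambda),$$ i.e. $\omega_G(\beta)=\sum_{\mathbf D}(-\beta)^{|\mathbf D|}\prod_{i\in V\setminus[\mathbf D]}\big(1+(d_i-1)\beta\big)$, the sum over all matchings $\mathbf D$ of $G$.
   Context: Loops count $2$ towards degrees $d_i$. $f_0=1,f_1=0,f_{n+1}(x)=xf_n(x)+f_{n-1}(x)$; $\theta_G(\beta,\gamma)=\sum_{s\subset E}\beta^{|s|}\prod_{i}f_{d_i(s)}(\gamma)$ ($d_i(s)$ the degree in $(V,s)$); $\omega_G(\beta)=\theta_G(\beta,2\sqrt{-1})/(1-\beta)^{|E|-|V|}$. A matching is a set of non-loop edges no two of which share a vertex (the empty set included); $[\mathbf D]$ is the set of vertices covered by $\mathbf D$. The monomer-dimer partition function with uniform dimer weight $\mu$ and monomer weights $\boldsymbol\lambda$ is $\Xi_G(\mu,\boldsymbol\lambda)=\sum_{\mathbf D}\mu^{|\mathbf D|}\prod_{i\in V\setminus[\mathbf D]}\lambda_i$. *)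

theory Defs
  imports Complex_Main "HOL-Library.Multiset"
    "HOL-Computational_Algebra.Polynomial" "HOL-Computational_Algebra.Fraction_Field"
begin

text \<open>Undirected multigraphs, with parallel edges and loops: each edge carries the two-element
  multiset of its ends, which is \<open>{#v, v#}\<close> for a loop at \<open>v\<close>.\<close>

record ('v, 'e) mgraph =
  vertex_set :: "'v set"
  edge_set :: "'e set"
  ends :: "'e \<Rightarrow> 'v multiset"

locale finite_multigraph =
  fixes G :: "('v, 'e) mgraph"
  assumes finite_vertices: "finite (vertex_set G)"
    and finite_edges: "finite (edge_set G)"
    and two_ends: "e \<in> edge_set G \<Longrightarrow> size (ends G e) = 2"
    and ends_in_vertices: "e \<in> edge_set G \<Longrightarrow> set_mset (ends G e) \<subseteq> vertex_set G"

text \<open>The degree in the spanning subgraph \<open>(V, s)\<close>; a loop contributes \<open>2\<close> to its vertex.\<close>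

definition sub_degree :: "('v, 'e) mgraph \<Rightarrow> 'e set \<Rightarrow> 'v \<Rightarrow> nat" where
  "sub_degree G s i = (\<Sum>e\<in>s. count (ends G e) i)"

definition degree_of :: "('v, 'e) mgraph \<Rightarrow> 'v \<Rightarrow> nat" where
  "degree_of G i = sub_degree G (edge_set G) i"

fun fpol :: "nat \<Rightarrow> 'a::comm_ring_1 \<Rightarrow> 'a" where
  "fpol 0 x = 1"
| "fpol (Suc 0) x = 0"
| "fpol (Suc (Suc n)) x = x * fpol (Suc n) x + fpol n x"

definition theta :: "('v, 'e) mgraph \<Rightarrow> 'a::comm_ring_1 \<Rightarrow> 'a \<Rightarrow> 'a" where
  "theta G \<beta> \<gamma> =
    (\<Sum>s\<in>Pow (edge_set G). \<beta> ^ card s * (\<Prod>i\<in>vertex_set G. fpol (sub_degree G s i) \<gamma>))"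

text \<open>The parameter \<open>\<iota>\<close> stands for the square root of \<open>-1\<close> in the field at hand. This lets \<open>\<omega>\<close> be
  taken both at complex numbers and, as a rational function, at the indeterminate of
  \<open>\<complex>(\<beta>)\<close>. The exponent is an integer, possibly negative; at the
  number \<open>\<beta> = 1\<close> the value of this expression is not meaningful.\<close>

definition omega :: "'a::field \<Rightarrow> ('v, 'e) mgraph \<Rightarrow> 'a \<Rightarrow> 'a" where
  "omega \<iota> G \<beta> =
    theta G \<beta> (2 * \<iota>) / (1 - \<beta>) powi (int (card (edge_set G)) - int (card (vertex_set G)))"

definition is_loop :: "('v, 'e) mgraph \<Rightarrow> 'e \<Rightarrow> bool" where
  "is_loop G e \<longleftrightarrow> (\<exists>v. ends G e = {#v, v#})"

definition is_matching :: "('v, 'e) mgraph \<Rightarrow> 'e set \<Rightarrow> bool" where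
  "is_matching G D \<longleftrightarrow> D \<subseteq> edge_set G \<and> (\<forall>e\<in>D. \<not> is_loop G e) \<and>
    (\<forall>e\<in>D. \<forall>e'\<in>D. e \<noteq> e' \<longrightarrow> set_mset (ends G e) \<inter> set_mset (ends G e') = {})"

definition covered :: "('v, 'e) mgraph \<Rightarrow> 'e set \<Rightarrow> 'v set" where
  "covered G D = (\<Union>e\<in>D. set_mset (ends G e))"

definition Xi :: "('v, 'e) mgraph \<Rightarrow> 'a::comm_ring_1 \<Rightarrow> ('v \<Rightarrow> 'a) \<Rightarrow> 'a" where
  "Xi G \<mu> w =
    (\<Sum>D\<in>{D. is_matching G D}. \<mu> ^ card D * (\<Prod>i\<in>vertex_set G - covered G D. w i))"

text \<open>The field of rational functions over the complex numbers, its indeterminate, and the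
  constant \<open>\<i>\<close> in it.\<close>

type_synonym ratfun = "complex poly fract"

definition rf_X :: ratfun where
  "rf_X = Fract [:0, 1:] 1"

definition rf_i :: ratfun where
  "rf_i = Fract [:\<i>:] 1"

end

theory Submission
  imports Defs
begin

text \<open>Since \<open>f\<^sub>n(2\<iota>) = \<iota>\<^sup>n (1 - n)\<close> and the degrees in \<open>(V, s)\<close> add up to \<open>2|s|\<close>, \<open>\<theta>\<close> equals
  \<open>\<Sum>s. (-\<beta>)\<^bsup>|s|\<^esup> \<Prod>i. (1 - d\<^sub>i(s))\<close>. Replacing \<open>1 - d\<^sub>i(s)\<close> by \<open>a\<^sub>i - d\<^sub>i(s)\<close> with arbitrary \<open>a\<close>
  gives a multi-affine function of \<open>a\<close>, which can be evaluated by induction on the edges: with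
  \<open>y = -\<beta>\<close> and \<open>p = y / (1 + y)\<close> it is \<open>(1 + y)\<^bsup>|E|\<^esup>\<close> times the monomer-dimer sum with dimer weight
  \<open>p (1 - p) = y / (1 + y)\<^sup>2\<close> and monomer weights \<open>a\<^sub>i - p d\<^sub>i\<close>.\<close>

text \<open>At \<open>2 * \<iota>\<close> the recurrence has characteristic polynomial
  \<open>x^2 - 2 \<iota> x - 1 = (x - \<iota>)^2\<close>. The double root explains the factor linear
  in \<open>n\<close>, and the initial values 1 and 0 fix it.\<close>

lemma fpol_double_imaginary_unit:
  fixes \<iota> :: "'a::comm_ring_1"
  assumes "\<iota> * \<iota> = -1"
  shows "fpol n (2 * \<iota>) = \<iota> ^ n * (1 - of_nat n)"
proof (induction n rule: induct_nat_012)
  case (ge2 n)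
  have "fpol (Suc (Suc n)) (2 * \<iota>) = (\<iota> * \<iota>) * \<iota> ^ n * (- 2 * of_nat n) + \<iota> ^ n * (1 - of_nat n)"
    using ge2 by (simp add: algebra_simps)
  also have "\<dots> = (\<iota> * \<iota>) * \<iota> ^ n * (1 - of_nat (Suc (Suc n)))"
    unfolding assms by (simp add: algebra_simps)
  finally show ?case by (simp add: mult.assoc)
qed simp_all

lemma sub_degree_insert:
  "finite s \<Longrightarrow> e \<notin> s \<Longrightarrow> sub_degree G (insert e s) i = count (ends G e) i + sub_degree G s i"
  by (simp add: sub_degree_def)

lemma covered_insert: "covered G (insert e D) = set_mset (ends G e) \<union> covered G D"
  by (simp add: covered_def)

lemma is_matching_subset: "is_matching G D \<Longrightarrow> D' \<subseteq> D \<Longrightarrow> is_matching G D'"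
  by (auto simp: is_matching_def subset_iff)

section \<open>Monomer-dimer sums on a set of edges and a set of vertices\<close>

definition matchings_within :: "('v, 'e) mgraph \<Rightarrow> 'e set \<Rightarrow> 'v set \<Rightarrow> 'e set set" where
  "matchings_within G E W = {D. is_matching G D \<and> D \<subseteq> E \<and> covered G D \<subseteq> W}"

text \<open>The two restrictions vary independently: the induction on edges enlarges
  \<open>E\<close>, while a change of weights deletes vertices from \<open>W\<close>. With all edges
  and all vertices this is the sum in \<open>Xi\<close>.\<close>

definition matching_sum ::
    "('v, 'e) mgraph \<Rightarrow> 'a::comm_ring_1 \<Rightarrow> 'e set \<Rightarrow> 'v set \<Rightarrow> ('v \<Rightarrow> 'a) \<Rightarrow> 'a" where
  "matching_sum G q E W w =
    (\<Sum>D\<in>matchings_within G E W. q ^ card D * (\<Prod>i\<in>W - covered G D. w i))"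

lemma finite_matchings_within: "finite E \<Longrightarrow> finite (matchings_within G E W)"
  by (rule finite_subset[of _ "Pow E"]) (auto simp: matchings_within_def)

lemma matching_sum_cong:
  "(\<And>i. i \<in> W \<Longrightarrow> w i = w' i) \<Longrightarrow> matching_sum G q E W w = matching_sum G q E W w'"
  by (auto simp: matching_sum_def intro!: sum.cong prod.cong)

text \<open>The derivative of the monomer-dimer sum in \<open>w\<^sub>u\<close> deletes the vertex \<open>u\<close>.\<close>

lemma matching_sum_update:
  assumes "finite E" "finite W" "u \<in> W"
  shows "matching_sum G q E W (w(u := c)) =
    matching_sum G q E W w + (c - w u) * matching_sum G q E (W - {u}) w"
proof -
  let ?M = "matchings_within G E W" and ?M' = "matchings_within G E (W - {u})"
  have sub: "?M' \<subseteq> ?M" by (auto simp: matchings_within_def)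
  have fin: "finite ?M" by (rule finite_matchings_within[OF assms(1)])
  have avoid: "q ^ card D * (\<Prod>i\<in>W - covered G D. (w(u := c)) i)
      = q ^ card D * (\<Prod>i\<in>W - covered G D. w i)
        + (c - w u) * (q ^ card D * (\<Prod>i\<in>W - {u} - covered G D. w i))" if "D \<in> ?M'" for D
  proof -
    have split: "W - covered G D = insert u (W - {u} - covered G D)"
      using that assms by (auto simp: matchings_within_def)
    have "(\<Prod>i\<in>W - {u} - covered G D. (w(u := c)) i) = (\<Prod>i\<in>W - {u} - covered G D. w i)"
      by (rule prod.cong) auto
    then show ?thesis
      unfolding split using assms by (simp add: algebra_simps)
  qed
  have meet: "q ^ card D * (\<Prod>i\<in>W - covered G D. (w(u := c)) i)
      = q ^ card D * (\<Prod>i\<in>W - covered G D. w i)" if "D \<in> ?M - ?M'" for D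
  proof -
    have "u \<in> covered G D" using that by (auto simp: matchings_within_def)
    then have "(\<Prod>i\<in>W - covered G D. (w(u := c)) i) = (\<Prod>i\<in>W - covered G D. w i)"
      by (intro prod.cong) auto
    then show ?thesis by simp
  qed
  show ?thesis
    unfolding matching_sum_def sum.subset_diff[OF sub fin]
    by (simp add: avoid meet sum.distrib sum_distrib_left del: fun_upd_apply)
qed

lemma matching_sum_insert_loop:
  assumes "is_loop G e"
  shows "matching_sum G q (insert e E) W w = matching_sum G q E W w"
proof -
  have "matchings_within G (insert e E) W = matchings_within G E W"
    using assms by (auto simp: matchings_within_def is_matching_def)
  then show ?thesis by (simp add: matching_sum_def)
qed

text \<open>Removing \<open>e\<close> maps the matchings that contain \<open>e\<close> bijectively
  to those that avoid both of its ends; each loses one factor \<open>q\<close>.\<close>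

lemma matching_sum_insert_edge:
  assumes "finite E" "e \<notin> E" "insert e E \<subseteq> edge_set G"
    and ends: "ends G e = {#u, v#}" and "u \<noteq> v" "u \<in> W" "v \<in> W"
  shows "matching_sum G q (insert e E) W w =
    matching_sum G q E W w + q * matching_sum G q E (W - {u, v}) w"
proof -
  let ?M = "matchings_within G E W" and ?M' = "matchings_within G E (W - {u, v})"
  have not_loop: "\<not> is_loop G e"
    using ends \<open>u \<noteq> v\<close> by (auto simp: is_loop_def dest!: arg_cong[where f = set_mset])
  have notin: "e \<notin> D" if "D \<in> ?M'" for D
    using that assms by (auto simp: matchings_within_def)
  have "is_matching G (insert e D)" if "D \<in> ?M'" for D
  proof -
    have "set_mset (ends G e') \<inter> {u, v} = {}" if "e' \<in> D" for e'
      using that \<open>D \<in> ?M'\<close> by (force simp: matchings_within_def covered_def)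
    then show ?thesis
      using that not_loop assms by (auto simp: matchings_within_def is_matching_def)
  qed
  then have "insert e ` ?M' \<subseteq> matchings_within G (insert e E) W"
    using assms by (auto simp: matchings_within_def covered_insert)
  moreover have "D \<in> ?M \<union> insert e ` ?M'" if D: "D \<in> matchings_within G (insert e E) W" for D
  proof (cases "e \<in> D")
    case True
    have "set_mset (ends G e') \<inter> {u, v} = {}" if "e' \<in> D - {e}" for e'
      using that True D ends by (fastforce simp: matchings_within_def is_matching_def)
    then have "covered G (D - {e}) \<subseteq> W - {u, v}"
      using D by (fastforce simp: matchings_within_def covered_def)
    moreover have "is_matching G (D - {e})"
      using D is_matching_subset by (fastforce simp: matchings_within_def)
    ultimately have "D - {e} \<in> ?M'"
      using D by (auto simp: matchings_within_def)
    then show ?thesis using True by (metis UnI2 image_eqI insert_Diff)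
  next
    case False
    then show ?thesis using D by (auto simp: matchings_within_def)
  qed
  moreover have "?M \<subseteq> matchings_within G (insert e E) W"
    by (auto simp: matchings_within_def)
  ultimately have split: "matchings_within G (insert e E) W = ?M \<union> insert e ` ?M'"
    by blast
  have disj: "?M \<inter> insert e ` ?M' = {}"
    using assms by (auto simp: matchings_within_def)
  have inj: "inj_on (insert e) ?M'"
    using notin by (auto intro!: inj_onI simp: insert_ident)
  have fin: "finite ?M" "finite (insert e ` ?M')"
    using finite_matchings_within[OF assms(1)] by auto
  have step: "q ^ card (insert e D) * (\<Prod>i\<in>W - covered G (insert e D). w i)
      = q * (q ^ card D * (\<Prod>i\<in>W - {u, v} - covered G D. w i))" if "D \<in> ?M'" for D
  proof -
    have "finite D"
      using that assms by (auto simp: matchings_within_def intro: finite_subset)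
    moreover have "W - covered G (insert e D) = W - {u, v} - covered G D"
      using ends by (auto simp: covered_insert)
    ultimately show ?thesis
      using notin[OF that] by (simp add: algebra_simps)
  qed
  show ?thesis
    unfolding matching_sum_def split sum.union_disjoint[OF fin disj]
    by (simp add: sum.reindex[OF inj] step sum_distrib_left)
qed

section \<open>Degree sums and the signed form of \<open>theta\<close>\<close>

context finite_multigraph
begin

lemma obtain_ends:
  assumes "e \<in> edge_set G"
  obtains u v where "ends G e = {#u, v#}" "u \<in> vertex_set G" "v \<in> vertex_set G"
proof -
  obtain u N where N: "ends G e = add_mset u N" "size N = 1"
    using two_ends[OF assms] size_eq_Suc_imp_eq_union[of "ends G e" 1] by auto
  then obtain v where "N = {#v#}" by (metis size_1_singleton_mset)
  with N show ?thesis
    using that ends_in_vertices[OF assms] by auto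
qed

lemma finite_subgraph: "s \<subseteq> edge_set G \<Longrightarrow> finite s"
  using finite_edges finite_subset by blast

text \<open>Double counting: every edge contributes the size of its multiset of ends, which is 2 for
  loops as well.\<close>

lemma sum_sub_degree:
  assumes "s \<subseteq> edge_set G"
  shows "(\<Sum>i\<in>vertex_set G. sub_degree G s i) = 2 * card s"
proof -
  have "(\<Sum>i\<in>vertex_set G. count (ends G e) i) = 2" if "e \<in> s" for e
  proof -
    have "(\<Sum>i\<in>vertex_set G. count (ends G e) i) = size (ends G e)"
      unfolding size_multiset_overloaded_eq
      by (rule sum.mono_neutral_right)
        (use that assms finite_vertices ends_in_vertices in \<open>auto simp: not_in_iff\<close>)
    then show ?thesis using that assms two_ends by auto
  qed
  then show ?thesis
    unfolding sub_degree_def by (subst sum.swap) simp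
qed

lemma theta_double_imaginary_unit:
  fixes \<iota> :: "'a::comm_ring_1"
  assumes "\<iota> * \<iota> = -1"
  shows "theta G \<beta> (2 * \<iota>) =
    (\<Sum>s\<in>Pow (edge_set G). (- \<beta>) ^ card s * (\<Prod>i\<in>vertex_set G. 1 - of_nat (sub_degree G s i)))"
  unfolding theta_def
proof (rule sum.cong[OF refl])
  fix s assume "s \<in> Pow (edge_set G)"
  \<comment> \<open>The degree sum is even, so the powers of \<open>\<iota>\<close> combine to a
    sign that turns \<open>\<beta>\<close> into \<open>- \<beta>\<close>.\<close>
  then have "(\<Prod>i\<in>vertex_set G. \<iota> ^ sub_degree G s i) = (\<iota> * \<iota>) ^ card s"
    by (simp add: sum_sub_degree power_mult power2_eq_square flip: power_sum)
  then show "\<beta> ^ card s * (\<Prod>i\<in>vertex_set G. fpol (sub_degree G s i) (2 * \<iota>)) =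
      (- \<beta>) ^ card s * (\<Prod>i\<in>vertex_set G. 1 - of_nat (sub_degree G s i))"
    by (simp add: fpol_double_imaginary_unit[OF assms] prod.distrib assms power_minus[of \<beta>])
qed

section \<open>Subgraph sums evaluated by induction on the edges\<close>

lemma subgraph_sum_insert:
  fixes a :: "'v \<Rightarrow> 'a::comm_ring_1"
  assumes "finite E" "e \<notin> E"
  shows "(\<Sum>s\<in>Pow (insert e E). y ^ card s * (\<Prod>i\<in>V. a i - of_nat (sub_degree G s i))) =
    (\<Sum>s\<in>Pow E. y ^ card s * (\<Prod>i\<in>V. a i - of_nat (sub_degree G s i))) +
    y * (\<Sum>s\<in>Pow E. y ^ card s *
      (\<Prod>i\<in>V. a i - of_nat (count (ends G e) i) - of_nat (sub_degree G s i)))"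
proof -
  have disj: "Pow E \<inter> insert e ` Pow E = {}" using assms by auto
  have inj: "inj_on (insert e) (Pow E)"
    using assms by (intro inj_onI) (metis PowD insert_ident subsetD)
  \<comment> \<open>The degrees contributed by \<open>e\<close> are absorbed into the weights
    \<open>a\<close>, so the induction has to keep \<open>a\<close> arbitrary.\<close>
  have "y ^ card (insert e s) * (\<Prod>i\<in>V. a i - of_nat (sub_degree G (insert e s) i)) =
      y * (y ^ card s *
        (\<Prod>i\<in>V. a i - of_nat (count (ends G e) i) - of_nat (sub_degree G s i)))"
    if "s \<in> Pow E" for s
  proof -
    have "finite s" "e \<notin> s" using that assms by (auto intro: finite_subset)
    then show ?thesis by (simp add: sub_degree_insert algebra_simps)
  qed
  then show ?thesis
    unfolding Pow_insert using assms disj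
    by (simp add: sum.union_disjoint sum.reindex[OF inj] sum_distrib_left)
qed

text \<open>Both sides are affine in each weight. Adding an edge \<open>e\<close> therefore reduces
  to comparing coefficients of matching sums in which some ends of \<open>e\<close> are
  deleted.\<close>

lemma subgraph_sum_eq_matching_sum:
  fixes y :: "'a::field" and a :: "'v \<Rightarrow> 'a"
  assumes "1 + y \<noteq> 0" "E \<subseteq> edge_set G"
  shows "(\<Sum>s\<in>Pow E. y ^ card s * (\<Prod>i\<in>vertex_set G. a i - of_nat (sub_degree G s i))) =
    (1 + y) ^ card E * matching_sum G (y / (1 + y)\<^sup>2) E (vertex_set G)
      (\<lambda>i. a i - y / (1 + y) * of_nat (sub_degree G E i))"
  using finite_subgraph[OF assms(2)] assms(2)
proof (induction E arbitrary: a rule: finite_induct)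
  case empty
  have "matchings_within G {} (vertex_set G) = {{}}"
    by (auto simp: matchings_within_def is_matching_def covered_def)
  then show ?case
    by (simp add: matching_sum_def sub_degree_def covered_def)
next
  case (insert e E)
  let ?V = "vertex_set G"
  define p where "p = y / (1 + y)"
  define q where "q = y / (1 + y)\<^sup>2"
  have yp: "y = (1 + y) * p" using assms by (simp add: p_def)
  \<comment> \<open>This closes the step for a non-loop: shifting both end weights by
    \<open>p\<close> puts \<open>p * p\<close> before the sum with both ends deleted, the dimer
    \<open>e\<close> adds \<open>q\<close>, and the total is \<open>p\<close>.\<close>
  have q: "q = p - p * p"
    using assms(1) by (simp add: p_def q_def divide_simps power2_eq_square) (simp add: algebra_simps)
  define b where "b i = a i - p * of_nat (sub_degree G E i)" for i
  let ?F = "\<lambda>W. matching_sum G q E W b"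
  have b_ins: "a i - p * of_nat (sub_degree G (insert e E) i) = b i - p * of_nat (count (ends G e) i)"
    for i
    using insert.hyps by (simp add: b_def sub_degree_insert algebra_simps)
  have b_shift: "a i - of_nat (count (ends G e) i) - p * of_nat (sub_degree G E i)
      = b i - of_nat (count (ends G e) i)" for i
    by (simp add: b_def)
  \<comment> \<open>The induction hypothesis is used twice, at \<open>a\<close> and at
    \<open>a\<close> lowered by the multiplicities of the ends of \<open>e\<close>.\<close>
  have "(\<Sum>s\<in>Pow (insert e E). y ^ card s * (\<Prod>i\<in>?V. a i - of_nat (sub_degree G s i))) =
      (1 + y) ^ card E * (?F ?V +
        y * matching_sum G q E ?V (\<lambda>i. b i - of_nat (count (ends G e) i)))"
    using insert unfolding subgraph_sum_insert[OF insert.hyps]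
    by (simp add: b_shift flip: p_def q_def b_def) (simp add: algebra_simps)
  also have "?F ?V + y * matching_sum G q E ?V (\<lambda>i. b i - of_nat (count (ends G e) i)) =
      (1 + y) * matching_sum G q (insert e E) ?V (\<lambda>i. b i - p * of_nat (count (ends G e) i))"
  proof -
    obtain u v where ends: "ends G e = {#u, v#}" and uv: "u \<in> ?V" "v \<in> ?V"
      using obtain_ends insert.prems by blast
    note upd = matching_sum_update[OF insert.hyps(1)]
    show ?thesis
    proof (cases "u = v")
      case True
      \<comment> \<open>Both \<open>c = 1\<close> (subgraphs containing \<open>e\<close>) and
        \<open>c = p\<close> (the target weights) are needed. A loop shifts one weight by
        \<open>2 * c\<close>.\<close>
      have shift: "matching_sum G q E ?V (\<lambda>i. b i - c * of_nat (count (ends G e) i)) =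
          ?F ?V - 2 * c * ?F (?V - {u})" for c
      proof -
        have "(\<lambda>i. b i - c * of_nat (count (ends G e) i)) = b(u := b u - 2 * c)"
          using ends True by auto
        then show ?thesis by (simp add: upd[OF finite_vertices uv(1)])
      qed
      have "is_loop G e" using ends True by (auto simp: is_loop_def)
      then have "(1 + y) * matching_sum G q (insert e E) ?V (\<lambda>i. b i - p * of_nat (count (ends G e) i))
          = (1 + y) * ?F ?V - 2 * ((1 + y) * p) * ?F (?V - {u})"
        by (simp add: matching_sum_insert_loop shift algebra_simps)
      also have "\<dots> = ?F ?V + y * (?F ?V - 2 * ?F (?V - {u}))"
        unfolding yp[symmetric] by (simp add: algebra_simps)
      finally show ?thesis
        using shift[of 1] by simp
    next
      case False
      \<comment> \<open>Two distinct weights now change, and affinity in each produces the mixed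
        term \<open>c * c\<close>.\<close>
      have shift: "matching_sum G q E ?V (\<lambda>i. b i - c * of_nat (count (ends G e) i)) =
          ?F ?V - c * ?F (?V - {u}) - c * ?F (?V - {v}) + c * c * ?F (?V - {u, v})" for c
      proof -
        have "?V - {v} - {u} = ?V - {u, v}" by blast
        then have del_v: "matching_sum G q E (?V - {v}) (b(u := b u - c)) =
            ?F (?V - {v}) - c * ?F (?V - {u, v})"
          using upd[of "?V - {v}" u G q b "b u - c"] finite_vertices uv False by simp
        have "(\<lambda>i. b i - c * of_nat (count (ends G e) i)) = b(u := b u - c, v := b v - c)"
          using ends False by auto
        then show ?thesis
          using False
          by (simp add: upd[OF finite_vertices uv(1)] upd[OF finite_vertices uv(2)] del_v)
            (simp add: algebra_simps)
      qed
      \<comment> \<open>Once \<open>u\<close> and \<open>v\<close> are deleted, the shift no longer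
        affects any remaining weight.\<close>
      have off: "matching_sum G q E (?V - {u, v}) (\<lambda>i. b i - p * of_nat (count (ends G e) i)) =
          ?F (?V - {u, v})"
        by (rule matching_sum_cong) (use ends in auto)
      have "(1 + y) * matching_sum G q (insert e E) ?V (\<lambda>i. b i - p * of_nat (count (ends G e) i))
          = (1 + y) * ?F ?V - ((1 + y) * p) * ?F (?V - {u}) - ((1 + y) * p) * ?F (?V - {v})
            + ((1 + y) * p) * ?F (?V - {u, v})"
        unfolding matching_sum_insert_edge[OF insert.hyps insert.prems ends False uv] shift off
        by (simp add: algebra_simps q)
      also have "\<dots> = ?F ?V + y * (?F ?V - ?F (?V - {u}) - ?F (?V - {v}) + ?F (?V - {u, v}))"
        unfolding yp[symmetric] by (simp add: algebra_simps)
      finally show ?thesis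
        using shift[of 1] by simp
    qed
  qed
  finally show ?case
    using insert.hyps by (simp add: b_ins flip: p_def q_def)
qed

section \<open>Rescaling to \<open>Xi\<close> and the value of \<open>omega\<close>\<close>

lemma card_covered:
  assumes "is_matching G D"
  shows "card (covered G D) = 2 * card D"
proof -
  have "card (set_mset (ends G e)) = 2" if "e \<in> D" for e
  proof -
    have "e \<in> edge_set G" "\<not> is_loop G e"
      using that assms by (auto simp: is_matching_def)
    moreover from this(1) obtain u v where "ends G e = {#u, v#}"
      by (rule obtain_ends)
    ultimately show ?thesis by (cases "u = v") (auto simp: is_loop_def)
  qed
  moreover have "finite D"
    using assms finite_subgraph by (auto simp: is_matching_def)
  ultimately show ?thesis
    unfolding covered_def using assms
    by (subst card_UN_disjoint) (auto simp: is_matching_def)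
qed

text \<open>Homogeneity: every vertex is a monomer or belongs to exactly one dimer, so
  \<open>c ^ card (vertex_set G)\<close> supplies one factor \<open>c\<close> per monomer and two
  per dimer.\<close>

lemma matching_sum_rescale:
  fixes c :: "'a::field"
  assumes "c \<noteq> 0"
  shows "c ^ card (vertex_set G) *
      matching_sum G (\<mu> / c\<^sup>2) (edge_set G) (vertex_set G) (\<lambda>i. w i / c) = Xi G \<mu> w"
proof -
  have cov: "covered G D \<subseteq> vertex_set G" if "is_matching G D" for D
    using that ends_in_vertices by (auto simp: covered_def is_matching_def subset_iff)
  then have within: "matchings_within G (edge_set G) (vertex_set G) = {D. is_matching G D}"
    by (auto simp: matchings_within_def is_matching_def)
  have "c ^ card (vertex_set G) *
      ((\<mu> / c\<^sup>2) ^ card D * (\<Prod>i\<in>vertex_set G - covered G D. w i / c)) =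
      \<mu> ^ card D * (\<Prod>i\<in>vertex_set G - covered G D. w i)" if "is_matching G D" for D
  proof -
    have "card (vertex_set G) = card (vertex_set G - covered G D) + 2 * card D"
      using cov[OF that] finite_vertices card_covered[OF that]
      by (metis card_Diff_subset card_mono finite_subset le_add_diff_inverse2)
    then show ?thesis
      using assms by (simp add: prod_dividef power_divide power_add power_mult)
  qed
  then show ?thesis
    by (simp add: matching_sum_def Xi_def within sum_distrib_left)
qed

lemma omega_eq_Xi:
  fixes \<iota> \<beta> :: "'a::field"
  assumes "\<iota> * \<iota> = -1" "\<beta> \<noteq> 1"
  shows "omega \<iota> G \<beta> = Xi G (- \<beta>) (\<lambda>i. 1 + (of_nat (degree_of G i) - 1) * \<beta>)"
proof -
  have nz: "1 - \<beta> \<noteq> 0" using assms by simp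
  let ?w = "\<lambda>i. 1 + (of_nat (degree_of G i) - 1) * \<beta>"
  \<comment> \<open>With \<open>y = - \<beta>\<close> and \<open>a = 1\<close>, this is
    \<open>a - p * d\<close> for a vertex of degree \<open>d\<close>, written over
    \<open>1 - \<beta>\<close> to fit the rescaling.\<close>
  have weight: "1 + \<beta> * of_nat (sub_degree G (edge_set G) i) / (1 - \<beta>) = ?w i / (1 - \<beta>)" for i
    using nz by (simp add: degree_of_def divide_simps) (simp add: algebra_simps)
  have "theta G \<beta> (2 * \<iota>) = (1 - \<beta>) ^ card (edge_set G) *
      matching_sum G (- \<beta> / (1 - \<beta>)\<^sup>2) (edge_set G) (vertex_set G) (\<lambda>i. ?w i / (1 - \<beta>))"
    using subgraph_sum_eq_matching_sum[of "- \<beta>" "edge_set G" "\<lambda>i. 1"] nz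
    by (simp add: theta_double_imaginary_unit[OF assms(1)] weight)
  then show ?thesis
    using nz matching_sum_rescale[OF nz, of "- \<beta>" ?w]
    by (simp add: omega_def power_int_diff mult.commute)
qed

end

theorem theorem7p14:
  fixes G :: "('v, 'e) mgraph"
  assumes "finite_multigraph G"
  shows "omega rf_i G rf_X = Xi G (- rf_X) (\<lambda>i. 1 + (of_nat (degree_of G i) - 1) * rf_X) \<and>
    (\<forall>\<beta>::complex. \<beta> \<noteq> 1 \<longrightarrow>
      omega \<i> G \<beta> = Xi G (- \<beta>) (\<lambda>i. 1 + (of_nat (degree_of G i) - 1) * \<beta>))"
proof -
  interpret finite_multigraph G by fact
  have "[:- 1:] = (- 1 :: complex poly)"
    by (simp add: one_pCons)
  then have "rf_i * rf_i = -1"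
    by (simp add: rf_i_def One_fract_def)
  \<comment> \<open>The indeterminate is not a constant, so the identity valid in every field
    applies to it.\<close>
  moreover have "rf_X \<noteq> 1"
    by (simp add: rf_X_def One_fract_def eq_fract one_pCons)
  ultimately show ?thesis
    by (simp add: omega_eq_Xi)
qed

end
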